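(* Let $M=(E,I)$ be a matroid on $m$ elements that is representable over $\mathbb{F}_2$ and satisfies a smooth circuit counting bound. Then there is a randomized algorithm using $O(\log m)$ adaptive rounds and $\mathrm{poly}(m)$ independence-oracle queries per round which finds a basis of $M$ with high probability.
   Context: A matroid $M=(E,I)$ is representable over $\mathbb{F}_2$ (binary) if there are vectors $v_e$ over $\mathbb{F}_2$, $e\in E$, such that $S\subseteq E$ is independent iff $\{v_e:e\in S\}$ is linearly independent over $\mathbb{F}_2$. A circuit is a minimal dependent set; its length is its cardinality. For $S\subseteq E$, $M|_S=(S,I\cap 2^S)$. $M$ satisfies a smooth circuit counting bound if there is a constant $K$ such that for every $S\subseteq E$, if $M|_S$ has minimum circuit length $\ell$, then for every positive integer $\alpha$ the number of circuits of length at most $\alpha\ell$ in $M|_S$ is at most $m^{K\alpha}$. The algorithm accesses $M$ only via an independence oracle that answers, for $S\subseteq E$, whether $S\in I$; in each adaptive round it submits a batch of queries depending on answers from earlier rounds. A basis is a maximal independent set. *)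

theory Defs
  imports
    "HOL-Probability.Probability_Mass_Function"
    "HOL-Library.Landau_Symbols"
    "HOL-Library.Function_Algebras"
    "HOL-Library.Z2"
begin

section \<open>Matroids\<close>

locale matroid =
  fixes E :: "'a set" and I :: "'a set set"
  assumes finite_ground: "finite E"
    and indep_subset_ground: "X \<in> I \<Longrightarrow> X \<subseteq> E"
    and indep_empty: "{} \<in> I"
    and indep_subset: "X \<in> I \<Longrightarrow> Y \<subseteq> X \<Longrightarrow> Y \<in> I"
    and indep_exchange: "X \<in> I \<Longrightarrow> Y \<in> I \<Longrightarrow> card X < card Y \<Longrightarrow> \<exists>y\<in>Y - X. insert y X \<in> I"

definition basis :: "'a set set \<Rightarrow> 'a set \<Rightarrow> bool" where
  "basis I B \<longleftrightarrow> B \<in> I \<and> (\<forall>X\<in>I. B \<subseteq> X \<longrightarrow> X = B)"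

definition circuits :: "'a set \<Rightarrow> 'a set set \<Rightarrow> 'a set set" where
  "circuits E I = {C. C \<subseteq> E \<and> C \<notin> I \<and> (\<forall>D. D \<subset> C \<longrightarrow> D \<in> I)}"

text \<open>The independent sets of the restriction to \<open>S\<close>, whose ground set is \<open>S\<close>.\<close>

definition restrict_indep :: "'a set set \<Rightarrow> 'a set \<Rightarrow> 'a set set" where
  "restrict_indep I S = I \<inter> Pow S"


section \<open>Binary matroids\<close>

definition f2_scale :: "bit \<Rightarrow> (nat \<Rightarrow> bit) \<Rightarrow> (nat \<Rightarrow> bit)" where
  "f2_scale c v = (\<lambda>i. c * v i)"

interpretation F2: vector_space f2_scale
  by unfold_locales
    (simp_all only: f2_scale_def fun_eq_iff plus_fun_apply distrib_left distrib_right mult.assoc mult_1_left simp_thms)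

text \<open>
  Every finite family of vectors over \<open>\<F>\<^sub>2\<close> lives, up to linear isomorphism of its span,
  in the space \<^typ>\<open>nat \<Rightarrow> bit\<close>. Linear independence is that of the indexed family
  \<open>(v e)\<close> for \<open>e \<in> S\<close>: two elements carrying the same vector are dependent (parallel),
  hence the injectivity.
\<close>

definition binary_matroid :: "'a set \<Rightarrow> 'a set set \<Rightarrow> bool" where
  "binary_matroid E I \<longleftrightarrow>
    (\<exists>v :: 'a \<Rightarrow> nat \<Rightarrow> bit. \<forall>S\<subseteq>E. S \<in> I \<longleftrightarrow> inj_on v S \<and> F2.independent (v ` S))"


section \<open>Smooth circuit counting\<close>

text \<open>
  Restrictions without circuits have no minimum circuit length and impose no condition.
  The base of the bound is the size of the whole ground set, also for proper restrictions.
\<close>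

definition smooth_circuit_bound :: "real \<Rightarrow> 'a set \<Rightarrow> 'a set set \<Rightarrow> bool" where
  "smooth_circuit_bound K E I \<longleftrightarrow>
    (\<forall>S\<subseteq>E. let Cs = circuits S (restrict_indep I S); l = Min (card ` Cs) in
      Cs \<noteq> {} \<longrightarrow>
      (\<forall>\<alpha>\<ge>1::nat. real (card {C\<in>Cs. card C \<le> \<alpha> * l}) \<le> real (card E) powr (K * real \<alpha>)))"


section \<open>Adaptive algorithms with an independence oracle\<close>

text \<open>
  A deterministic algorithm either stops with an output, or submits a batch \<open>Q\<close> of
  queries and continues depending on the set of those members of \<open>Q\<close> which the oracle
  declares independent. As usual in the oracle model, only rounds and queries are counted.
  A randomized algorithm is a probability distribution over deterministic ones.
\<close>

datatype 'a oracle_alg =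
    Output "'a set"
  | Query "'a set set" "'a set set \<Rightarrow> 'a oracle_alg"

primrec result :: "'a set set \<Rightarrow> 'a oracle_alg \<Rightarrow> 'a set" where
  "result I (Output B) = B"
| "result I (Query Q k) = result I (k (Q \<inter> I))"

primrec batches :: "'a set set \<Rightarrow> 'a oracle_alg \<Rightarrow> 'a set set list" where
  "batches I (Output B) = []"
| "batches I (Query Q k) = Q # batches I (k (Q \<inter> I))"

definition rounds :: "'a set set \<Rightarrow> 'a oracle_alg \<Rightarrow> nat" where
  "rounds I a = length (batches I a)"

end

theory Submission
  imports Defs "HOL-Probability.Product_PMF"
begin

text \<open>
  Keep a set \<open>S\<close> containing a basis, of girth \<open>l\<close>. In a binary matroid the symmetric difference of
  two distinct circuits contains a circuit, so a circuit \<open>C\<close> of \<open>S\<close> of length at most \<open>3l/2\<close> misses a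
  constant fraction of every other circuit. By the counting bound, a random set \<open>T\<close> of density
  \<open>m powr (-x/l)\<close>, with \<open>x\<close> a large constant, therefore contains \<open>C\<close> but no other circuit of \<open>S\<close> with
  probability \<open>1/poly(m)\<close>. Then \<open>C\<close> consists of those \<open>e\<close> for which \<open>T \<inter> S - {e}\<close> is independent, so that
  one batch of queries finds all circuits of length at most \<open>3l/2\<close>. Deleting from each circuit found its
  last element, in a fixed order of the ground set, keeps a basis in \<open>S\<close> and multiplies the girth
  by \<open>3/2\<close>; when the girth exceeds \<open>m\<close>, \<open>S\<close> is independent.

  With polynomially many samples the failure probability for a single pair \<open>(S, C)\<close> is below
  \<open>4\<^sup>-\<^sup>m\<close>, which pays for a union bound over all such pairs. Hence one nonadaptive sample can be
  reused in every round.
\<close>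

section \<open>Matroids and their circuits\<close>

context matroid
begin

lemma finite_subset_ground: "X \<subseteq> E \<Longrightarrow> finite X"
  using finite_ground finite_subset by blast

lemma circuitsD:
  assumes "C \<in> circuits E I"
  shows "C \<subseteq> E" "C \<notin> I" "finite C" "C \<noteq> {}" "\<And>D. D \<subset> C \<Longrightarrow> D \<in> I"
  using assms indep_empty finite_subset_ground unfolding circuits_def by auto

text \<open>Turns the counting bound for restrictions into statements about those circuits of the
  whole matroid that lie in \<open>S\<close>; only the latter occur in the rest of the
  argument.\<close>

lemma circuits_restrict_indep:
  assumes "S \<subseteq> E"
  shows "circuits S (restrict_indep I S) = {C \<in> circuits E I. C \<subseteq> S}"
  using assms unfolding circuits_def restrict_indep_def by auto

lemma finite_circuits: "finite {C \<in> circuits E I. P C}"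
  by (rule finite_subset[of _ "Pow E"]) (auto simp: circuits_def finite_ground)

lemma dependent_contains_circuit:
  assumes "X \<subseteq> E" "X \<notin> I"
  obtains C where "C \<in> circuits E I" "C \<subseteq> X"
proof -
  have "finite {D. D \<subseteq> X \<and> D \<notin> I}"
    using finite_subset_ground[OF assms(1)] by simp
  moreover have "X \<in> {D. D \<subseteq> X \<and> D \<notin> I}"
    using assms by simp
  ultimately obtain C where C: "C \<subseteq> X" "C \<notin> I"
    and min: "\<And>D. D \<in> {D. D \<subseteq> X \<and> D \<notin> I} \<Longrightarrow> D \<subseteq> C \<Longrightarrow> C = D"
    using finite_has_minimal2[of "{D. D \<subseteq> X \<and> D \<notin> I}" X] by auto
  have "C \<in> circuits E I"
    unfolding circuits_def using C min assms(1) by blast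
  with C that show ?thesis by blast
qed

section \<open>Augmentation and independent sets of maximum cardinality\<close>

lemma indep_augment_to_card:
  assumes "X \<in> I" "Y \<in> I" "card X \<le> card Y"
  obtains J where "J \<in> I" "X \<subseteq> J" "J \<subseteq> X \<union> Y" "card J = card Y"
  using assms(1,3)
proof (induction "card Y - card X" arbitrary: X thesis)
  case 0
  then show ?case by auto
next
  case (Suc n)
  then have "card X < card Y"
    by linarith
  then obtain y where y: "y \<in> Y - X" "insert y X \<in> I"
    using indep_exchange[of X Y] assms(2) Suc.prems(2) by blast
  have "finite X"
    using Suc.prems(2) indep_subset_ground finite_subset_ground by blast
  then have card: "card (insert y X) = Suc (card X)"
    using y by simp
  show ?case
  proof (rule Suc.hyps(1)[OF _ _ y(2)])
    show "n = card Y - card (insert y X)" "card (insert y X) \<le> card Y"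
      using Suc.hyps(2) Suc.prems card by auto
    show thesis if "J \<in> I" "insert y X \<subseteq> J" "J \<subseteq> insert y X \<union> Y" "card J = card Y" for J
      using that y Suc.prems(1)[of J] by auto
  qed
qed

lemma ex_max_card_indep: "\<exists>B\<subseteq>E. B \<in> I \<and> (\<forall>X\<in>I. card X \<le> card B)"
proof -
  have "card X < Suc (card E)" if "X \<in> I" for X
    using that indep_subset_ground card_mono[OF finite_ground] by (simp add: less_Suc_eq_le)
  then obtain B where "B \<in> I" "\<And>X. X \<in> I \<Longrightarrow> card X \<le> card B"
    using ex_has_greatest_nat[of "\<lambda>X. X \<in> I" "{}" card "Suc (card E)"] indep_empty by blast
  then show ?thesis
    using indep_subset_ground by blast
qed

text \<open>The invariant of the algorithm is that \<open>S\<close> contains an independent set of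
  maximum cardinality, a form suited to exchange arguments. Once \<open>S\<close> is itself
  independent, this yields the required basis.\<close>

lemma basis_of_max_card:
  assumes "S \<in> I" "B \<subseteq> S" "\<And>X. X \<in> I \<Longrightarrow> card X \<le> card B"
  shows "basis I S"
  unfolding basis_def
proof (intro conjI ballI impI)
  fix X assume X: "X \<in> I" "S \<subseteq> X"
  have fin: "finite X" "finite S"
    using X assms(1) indep_subset_ground finite_subset_ground by blast+
  have "card X \<le> card S"
    using assms(3)[OF X(1)] card_mono[OF fin(2) assms(2)] by simp
  then show "X = S"
    using X(2) fin card_seteq by blast
qed (fact assms(1))

text \<open>Among the maximum independent subsets of \<open>S\<close>, one of least total \<open>g\<close>-weight avoids the
  heaviest element of every circuit: a heavier element could be exchanged for a lighter one.\<close>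

lemma max_card_indep_avoids_circuit_maxima:
  fixes g :: "'a \<Rightarrow> nat"
  assumes g: "inj_on g E" and "S \<subseteq> E"
    and B: "B \<subseteq> S" "B \<in> I" "\<And>X. X \<in> I \<Longrightarrow> card X \<le> card B"
    and R: "\<And>e. e \<in> R \<Longrightarrow> \<exists>C\<in>circuits E I. C \<subseteq> S \<and> e \<in> C \<and> (\<forall>y\<in>C. g y \<le> g e)"
  obtains B' where "B' \<subseteq> S - R" "B' \<in> I" "\<And>X. X \<in> I \<Longrightarrow> card X \<le> card B'"
proof -
  define P where "P X \<longleftrightarrow> X \<subseteq> S \<and> X \<in> I \<and> card X = card B" for X
  have "P B" using B by (simp add: P_def)
  then obtain M where M: "P M" and min: "\<And>X. P X \<Longrightarrow> sum g M \<le> sum g X"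
    using ex_has_least_nat[of P B "sum g"] by blast
  have "M \<inter> R = {}"
  proof (rule ccontr)
    assume "M \<inter> R \<noteq> {}"
    then obtain e C where e: "e \<in> M" and C: "C \<in> circuits E I" "C \<subseteq> S" "e \<in> C" "\<forall>y\<in>C. g y \<le> g e"
      using R by blast
    have finM: "finite M"
      using M \<open>S \<subseteq> E\<close> finite_subset_ground unfolding P_def by blast
    have "C - {e} \<in> I"
      using circuitsD(5)[OF C(1)] C(3) by blast
    moreover have "card (C - {e}) \<le> card M"
      using B(3)[OF \<open>C - {e} \<in> I\<close>] M unfolding P_def by simp
    \<comment> \<open>Filling up \<open>C - {e}\<close> from \<open>M\<close> cannot restore
      \<open>e\<close>, since \<open>J\<close> would then contain \<open>C\<close>. So an element
      exchanged from \<open>J\<close> into \<open>M - {e}\<close> must come from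
      \<open>C - {e}\<close> and be lighter than \<open>e\<close>.\<close>
    ultimately obtain J where J: "J \<in> I" "C - {e} \<subseteq> J" "J \<subseteq> (C - {e}) \<union> M" "card J = card M"
      using indep_augment_to_card[of "C - {e}" M] M unfolding P_def by blast
    have "e \<notin> J"
    proof
      assume "e \<in> J"
      then have "C \<subseteq> J" using J(2) by blast
      then show False using indep_subset[OF J(1)] circuitsD(2)[OF C(1)] by blast
    qed
    have "M - {e} \<in> I"
      using indep_subset[of M "M - {e}"] M unfolding P_def by blast
    moreover have "card (M - {e}) < card J"
      using J(4) e finM by (metis card_Diff1_less)
    ultimately obtain y where y: "y \<in> J - (M - {e})" "insert y (M - {e}) \<in> I"
      using indep_exchange J(1) by blast
    have yC: "y \<in> C" "y \<noteq> e" "y \<notin> M"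
      using y(1) J(3) \<open>e \<notin> J\<close> by auto
    have "g y \<noteq> g e"
      using yC C e circuitsD(1)[OF C(1)] inj_onD[OF g, of y e] by blast
    then have less: "g y < g e"
      using C(4) yC(1) by (simp add: le_neq_implies_less)
    have "card (insert y (M - {e})) = card M"
      using yC e finM by (metis DiffD1 card_insert_disjoint card.remove finite_Diff)
    then have "P (insert y (M - {e}))"
      using y(2) yC C(2) M unfolding P_def by auto
    then have "sum g M \<le> sum g (insert y (M - {e}))"
      by (rule min)
    moreover have "sum g M = g e + sum g (M - {e})"
      using finM e by (simp add: sum.remove)
    moreover have "sum g (insert y (M - {e})) = g y + sum g (M - {e})"
      using finM yC by simp
    ultimately show False
      using less by simp
  qed
  then show ?thesis
    using that[of M] M B(3) unfolding P_def by auto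
qed

end


section \<open>Binary matroids\<close>

locale binary_matroid_locale = matroid +
  assumes binary: "binary_matroid E I"
begin

text \<open>The coefficients over the two-element field are 0 and 1, so a linear dependency is a
  nonempty subset whose vectors sum to zero. Summing over elements rather than over vectors also
  treats parallel elements correctly.\<close>

lemma obtain_even_sets:
  obtains v :: "'a \<Rightarrow> nat \<Rightarrow> bit"
  where "\<And>S. S \<subseteq> E \<Longrightarrow> S \<notin> I \<longleftrightarrow> (\<exists>X\<subseteq>S. X \<noteq> {} \<and> sum v X = 0)"
proof -
  obtain v :: "'a \<Rightarrow> nat \<Rightarrow> bit"
    where v: "\<And>S. S \<subseteq> E \<Longrightarrow> S \<in> I \<longleftrightarrow> inj_on v S \<and> F2.independent (v ` S)"
    using binary unfolding binary_matroid_def by blast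
  have scale1: "f2_scale 1 x = x" and scale0: "f2_scale 0 x = 0" for x
    by (simp_all add: f2_scale_def fun_eq_iff)
  have "S \<notin> I \<longleftrightarrow> (\<exists>X\<subseteq>S. X \<noteq> {} \<and> sum v X = 0)" if S: "S \<subseteq> E" for S
  proof
    assume "\<exists>X\<subseteq>S. X \<noteq> {} \<and> sum v X = 0"
    then obtain X where X: "X \<subseteq> S" "X \<noteq> {}" "sum v X = 0" by blast
    show "S \<notin> I"
    proof
      assume "S \<in> I"
      then have inj: "inj_on v X" and ind: "F2.independent (v ` S)"
        using v[OF S] X(1) inj_on_subset by blast+
      have "(\<Sum>x\<in>v ` X. f2_scale 1 x) = 0"
        using X(3) by (simp add: scale1 sum.reindex[OF inj])
      moreover have "finite (v ` X)" "v ` X \<subseteq> v ` S"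
        using X(1) S finite_subset_ground by auto
      moreover have "\<exists>x\<in>v ` X. (1 :: bit) \<noteq> 0"
        using X(2) by auto
      ultimately have "F2.dependent (v ` S)"
        unfolding F2.dependent_explicit by (intro exI[of _ "v ` X"] exI[of _ "\<lambda>_. 1"] conjI)
      then show False using ind by simp
    qed
  next
    assume "S \<notin> I"
    then consider "\<not> inj_on v S" | "inj_on v S" "F2.dependent (v ` S)"
      using v[OF S] by blast
    then show "\<exists>X\<subseteq>S. X \<noteq> {} \<and> sum v X = 0"
    proof cases
      case 1
      then obtain a b where ab: "a \<in> S" "b \<in> S" "a \<noteq> b" "v a = v b"
        unfolding inj_on_def by blast
      \<comment> \<open>Two parallel elements cancel in characteristic 2.\<close>
      have "sum v {a, b} = 0"
        using ab by (simp add: fun_eq_iff)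
      then show ?thesis
        using ab by (intro exI[of _ "{a, b}"]) auto
    next
      case 2
      then obtain t u where t: "finite t" "t \<subseteq> v ` S" "(\<Sum>x\<in>t. f2_scale (u x) x) = 0" "\<exists>x\<in>t. u x \<noteq> 0"
        unfolding F2.dependent_explicit by blast
      \<comment> \<open>The support of the coefficients, pulled back to elements; injectivity makes
        each vector occur exactly once.\<close>
      define X where "X = {e \<in> S. v e \<in> t \<and> u (v e) = 1}"
      have inj: "inj_on v X"
        using 2(1) by (rule inj_on_subset) (auto simp: X_def)
      have image: "v ` X = {x \<in> t. u x = 1}"
        using t(2) unfolding X_def by blast
      have "sum v X = (\<Sum>x\<in>v ` X. x)"
        by (simp add: sum.reindex[OF inj])
      also have "\<dots> = (\<Sum>x\<in>t. f2_scale (u x) x)"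
      proof (rule sum.mono_neutral_cong_left[OF t(1)])
        show "v ` X \<subseteq> t" "\<forall>x\<in>t - v ` X. f2_scale (u x) x = 0" "\<And>x. x \<in> v ` X \<Longrightarrow> x = f2_scale (u x) x"
          unfolding image by (auto simp: scale0 scale1)
      qed
      finally have "sum v X = 0" using t(3) by simp
      moreover have "X \<noteq> {}"
        using image t(4) bit_not_zero_iff by blast
      moreover have "X \<subseteq> S"
        unfolding X_def by blast
      ultimately show ?thesis
        by blast
    qed
  qed
  then show thesis by (rule that)
qed

text \<open>By minimality a circuit is itself its zero-sum subset. Adding the zero sums of two
  circuits counts their intersection twice, so it cancels and the symmetric difference sums to
  zero.\<close>

lemma circuits_sym_diff_dependent:
  assumes C: "C \<in> circuits E I" and D: "D \<in> circuits E I" and "C \<noteq> D"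
  shows "(C - D) \<union> (D - C) \<notin> I"
proof -
  obtain v :: "'a \<Rightarrow> nat \<Rightarrow> bit"
    where v: "\<And>S. S \<subseteq> E \<Longrightarrow> S \<notin> I \<longleftrightarrow> (\<exists>X\<subseteq>S. X \<noteq> {} \<and> sum v X = 0)"
    using obtain_even_sets by blast
  have zero: "sum v C = 0" if C: "C \<in> circuits E I" for C
  proof -
    obtain X where X: "X \<subseteq> C" "X \<noteq> {}" "sum v X = 0"
      using v[of C] circuitsD(1,2)[OF C] by blast
    then have "X \<notin> I"
      using v[of X] circuitsD(1)[OF C] by blast
    then show ?thesis
      using X circuitsD(5)[OF C, of X] by blast
  qed
  have fin: "finite C" "finite D"
    using circuitsD(3) C D by auto
  have "sum v C = sum v (C - D) + sum v (C \<inter> D)"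
    using sum.Int_Diff[OF fin(1), of v D] by (simp add: add.commute)
  moreover have "sum v D = sum v (D - C) + sum v (C \<inter> D)"
    using sum.Int_Diff[OF fin(2), of v C] by (simp add: add.commute Int_commute)
  moreover have "sum v (C \<inter> D) + sum v (C \<inter> D) = 0"
    by (simp add: fun_eq_iff)
  moreover have "(sum v (C - D) + sum v (C \<inter> D)) + (sum v (D - C) + sum v (C \<inter> D)) =
      (sum v (C - D) + sum v (D - C)) + (sum v (C \<inter> D) + sum v (C \<inter> D))"
    by (simp only: ac_simps)
  ultimately have "sum v (C - D) + sum v (D - C) = 0"
    using zero[OF C] zero[OF D] by simp
  then have "sum v ((C - D) \<union> (D - C)) = 0"
    using fin by (subst sum.union_disjoint) auto
  moreover have "(C - D) \<union> (D - C) \<noteq> {}" "(C - D) \<union> (D - C) \<subseteq> E"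
    using \<open>C \<noteq> D\<close> circuitsD(1)[OF C] circuitsD(1)[OF D] by auto
  ultimately show ?thesis
    using v by blast
qed

text \<open>Circuit elimination: the symmetric difference avoids \<open>e\<close>, hence is a
  dependent subset of \<open>C \<union> D - {e}\<close>.\<close>

lemma circuits_eliminate:
  assumes "C \<in> circuits E I" "D \<in> circuits E I" "C \<noteq> D" "e \<in> C \<inter> D"
  shows "C \<union> D - {e} \<notin> I"
  using circuits_sym_diff_dependent[OF assms(1-3)] indep_subset[of "C \<union> D - {e}" "(C - D) \<union> (D - C)"]
    assms(4) by blast

text \<open>Soundness of the test on any sample: the element \<open>e\<close> lies in every circuit
  of \<open>X\<close>, so elimination applied to two distinct circuits would leave a dependent set
  avoiding \<open>e\<close>. Hence \<open>X\<close> has one circuit, and its elements are the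
  critical ones.\<close>

lemma circuit_of_critical_elements:
  assumes "X \<subseteq> E" "X \<notin> I" "e \<in> X" "X - {e} \<in> I"
  shows "{x \<in> X. X - {x} \<in> I} \<in> circuits E I"
proof -
  obtain C where C: "C \<in> circuits E I" "C \<subseteq> X"
    using dependent_contains_circuit assms(1,2) by blast
  have crit: "x \<in> D" if "D \<in> circuits E I" "D \<subseteq> X" "X - {x} \<in> I" for x D
    using that indep_subset[of "X - {x}" D] circuitsD(2)[of D] by blast
  have "X - {x} \<in> I" if "x \<in> C" for x
  proof (rule ccontr)
    assume "X - {x} \<notin> I"
    then obtain D where D: "D \<in> circuits E I" "D \<subseteq> X - {x}"
      using dependent_contains_circuit[of "X - {x}"] assms(1) by blast
    have "e \<in> C \<inter> D" using crit C D assms(4) by blast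
    then have "C \<union> D - {e} \<notin> I"
      using circuits_eliminate[OF C(1) D(1)] that D(2) by blast
    then show False
      using indep_subset[OF assms(4), of "C \<union> D - {e}"] C(2) D(2) by blast
  qed
  then have "{x \<in> X. X - {x} \<in> I} = C"
    using crit C by blast
  then show ?thesis using C(1) by simp
qed

text \<open>Completeness of the test: deleting any element of the only circuit leaves no circuit at
  all.\<close>

lemma critical_elements_of_unique_circuit:
  assumes "X \<subseteq> E" "C \<in> circuits E I" "\<And>D. D \<in> circuits E I \<Longrightarrow> D \<subseteq> X \<longleftrightarrow> D = C"
  shows "X \<notin> I" "{x \<in> X. X - {x} \<in> I} = C"
proof -
  have "C \<subseteq> X" using assms by blast
  then show "X \<notin> I"
    using indep_subset[of X C] circuitsD(2)[OF assms(2)] by blast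
  have "X - {x} \<in> I" if x: "x \<in> C" for x
  proof (rule ccontr)
    assume "X - {x} \<notin> I"
    then obtain D where D: "D \<in> circuits E I" "D \<subseteq> X - {x}"
      using dependent_contains_circuit[of "X - {x}"] assms(1) by blast
    then have "D = C" using assms(3) by blast
    then show False using D(2) x by blast
  qed
  moreover have "x \<in> C" if "X - {x} \<in> I" for x
    using that \<open>C \<subseteq> X\<close> indep_subset[of "X - {x}" C] circuitsD(2)[OF assms(2)] by blast
  ultimately show "{x \<in> X. X - {x} \<in> I} = C"
    using \<open>C \<subseteq> X\<close> by blast
qed

end


section \<open>The deletion algorithm\<close>

definition queries :: "'a set set \<Rightarrow> 'a set \<Rightarrow> 'a set set" where
  "queries F S = (\<Union>T\<in>F. insert (T \<inter> S) ((\<lambda>e. T \<inter> S - {e}) ` (T \<inter> S)))"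

text \<open>The condition \<open>X \<notin> I\<close> makes the set empty for independent
  \<open>X\<close>, where every single deletion would pass.\<close>

definition critical :: "'a set set \<Rightarrow> 'a set \<Rightarrow> 'a set" where
  "critical I X = {x \<in> X. X \<notin> I \<and> X - {x} \<in> I}"

definition deleted :: "('a \<Rightarrow> nat) \<Rightarrow> 'a set set \<Rightarrow> 'a set set \<Rightarrow> 'a set \<Rightarrow> 'a set" where
  "deleted g F I S = {e. \<exists>T\<in>F. e \<in> critical I (T \<inter> S) \<and> (\<forall>y\<in>critical I (T \<inter> S). g y \<le> g e)}"

text \<open>The number of rounds is fixed in advance, with no stopping test, and the same sample
  \<open>F\<close> serves all of them. The oracle's answers \<open>J\<close> take the place of
  \<open>I\<close>.\<close>

primrec deletion_alg :: "('a \<Rightarrow> nat) \<Rightarrow> 'a set set \<Rightarrow> nat \<Rightarrow> 'a set \<Rightarrow> 'a oracle_alg" where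
  "deletion_alg g F 0 S = Output S"
| "deletion_alg g F (Suc t) S =
    Query (queries F S) (\<lambda>J. deletion_alg g F t (S - deleted g F J S))"

text \<open>The batch contains every set whose independence is tested, so the oracle's answers are
  as good as \<open>I\<close> itself.\<close>

lemma critical_queries:
  assumes "T \<in> F"
  shows "critical (queries F S \<inter> I) (T \<inter> S) = critical I (T \<inter> S)"
  using assms unfolding critical_def queries_def by blast

lemma deleted_queries [simp]: "deleted g F (queries F S \<inter> I) S = deleted g F I S"
  unfolding deleted_def by (simp add: critical_queries cong: bex_cong)

lemma rounds_deletion_alg: "rounds I (deletion_alg g F t S) = t"
  by (induction t arbitrary: S) (simp_all add: rounds_def)

lemma card_queries:
  assumes "finite F" "S \<subseteq> E" "finite E"
  shows "card (queries F S) \<le> card F * Suc (card E)"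
proof -
  have "card (queries F S) \<le> (\<Sum>T\<in>F. card (insert (T \<inter> S) ((\<lambda>e. T \<inter> S - {e}) ` (T \<inter> S))))"
    unfolding queries_def by (rule card_UN_le[OF assms(1)])
  also have "\<dots> \<le> (\<Sum>T\<in>F. Suc (card E))"
  proof (rule sum_mono)
    fix T
    have fin: "finite (T \<inter> S)"
      using assms finite_subset by blast
    then have "card ((\<lambda>e. T \<inter> S - {e}) ` (T \<inter> S)) \<le> card E"
      using assms(2,3) card_image_le[OF fin, of "\<lambda>e. T \<inter> S - {e}"] card_mono[of E "T \<inter> S"] by fastforce
    then show "card (insert (T \<inter> S) ((\<lambda>e. T \<inter> S - {e}) ` (T \<inter> S))) \<le> Suc (card E)"
      using fin by (simp add: card_insert_if)
  qed
  finally show ?thesis by simp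
qed

lemma batches_deletion_alg:
  assumes "Q \<in> set (batches I (deletion_alg g F t S))" "finite F" "S \<subseteq> E" "finite E"
  shows "Q \<subseteq> Pow E" "card Q \<le> card F * Suc (card E)"
proof -
  have "\<exists>S'\<subseteq>E. Q = queries F S'"
    using assms(1,3)
  proof (induction t arbitrary: S)
    case (Suc t)
    show ?case
    proof (cases "Q = queries F S")
      case False
      then have "Q \<in> set (batches I (deletion_alg g F t (S - deleted g F I S)))"
        using Suc.prems(1) by simp
      then show ?thesis
        using Suc.IH[of "S - deleted g F I S"] Suc.prems(2) by blast
    qed (use Suc.prems in blast)
  qed simp
  then obtain S' where S': "S' \<subseteq> E" "Q = queries F S'" by blast
  then show "Q \<subseteq> Pow E"
    unfolding queries_def by blast
  show "card Q \<le> card F * Suc (card E)"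
    using card_queries[OF assms(2) S'(1) assms(4)] S'(2) by simp
qed

section \<open>Girth, isolating families and correctness of the deletion rounds\<close>

definition girth :: "'a set \<Rightarrow> 'a set set \<Rightarrow> 'a set \<Rightarrow> nat" where
  "girth E I S = Min (card ` {C \<in> circuits E I. C \<subseteq> S})"

definition isolates :: "'a set \<Rightarrow> 'a set set \<Rightarrow> 'a set \<Rightarrow> 'a set \<Rightarrow> 'a set \<Rightarrow> bool" where
  "isolates E I S C T \<longleftrightarrow> (\<forall>D\<in>circuits E I. D \<subseteq> T \<inter> S \<longleftrightarrow> D = C)"

text \<open>The guarantee is uniform in \<open>S\<close> because the sets reached in later rounds
  depend on \<open>F\<close>. The inequality is the threshold of 3/2 times the girth, cleared of
  fractions.\<close>

definition isolating_family :: "'a set \<Rightarrow> 'a set set \<Rightarrow> 'a set set \<Rightarrow> bool" where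
  "isolating_family E I F \<longleftrightarrow>
    (\<forall>S\<subseteq>E. \<forall>C\<in>circuits E I. C \<subseteq> S \<and> 2 * card C \<le> 3 * girth E I S \<longrightarrow> (\<exists>T\<in>F. isolates E I S C T))"

context matroid
begin

lemma girth_le: "C \<in> circuits E I \<Longrightarrow> C \<subseteq> S \<Longrightarrow> girth E I S \<le> card C"
  unfolding girth_def using finite_circuits by (intro Min_le) auto

text \<open>The girth is a \<open>Min\<close>, which is meaningful only if \<open>S\<close> contains
  a circuit; hence the hypothesis.\<close>

lemma girth_attained:
  assumes "C \<in> circuits E I" "C \<subseteq> S"
  obtains D where "D \<in> circuits E I" "D \<subseteq> S" "card D = girth E I S"
proof -
  have "girth E I S \<in> card ` {C \<in> circuits E I. C \<subseteq> S}"
    unfolding girth_def using finite_circuits assms by (intro Min_in) auto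
  then show ?thesis
    using that by auto
qed

end

context binary_matroid_locale
begin

lemma critical_circuit:
  assumes "X \<subseteq> E" "e \<in> critical I X"
  shows "critical I X \<in> circuits E I"
proof -
  have "X \<notin> I" "e \<in> X" "X - {e} \<in> I"
    using assms(2) unfolding critical_def by auto
  then show ?thesis
    using circuit_of_critical_elements[OF assms(1)] unfolding critical_def by simp
qed

lemma critical_isolates:
  assumes "S \<subseteq> E" "C \<in> circuits E I" "isolates E I S C T"
  shows "critical I (T \<inter> S) = C"
  using critical_elements_of_unique_circuit[of "T \<inter> S" C] assms
  unfolding critical_def isolates_def by (auto simp: le_infI2)

text \<open>A short circuit is isolated by some member of the family, hence found exactly, and then
  its heaviest element is deleted.\<close>

lemma deletion_destroys_short_circuits:
  assumes "isolating_family E I F" "S \<subseteq> E" "C \<in> circuits E I" "C \<subseteq> S - deleted g F I S"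
  shows "3 * girth E I S < 2 * card C"
proof (rule ccontr)
  assume "\<not> 3 * girth E I S < 2 * card C"
  then obtain T where T: "T \<in> F" "isolates E I S C T"
    using assms unfolding isolating_family_def by (metis Diff_subset leI order_trans)
  then have crit: "critical I (T \<inter> S) = C"
    using critical_isolates assms by blast
  obtain e where "e \<in> C" "\<forall>y\<in>C. g y \<le> g e"
    using obtains_MAX[OF circuitsD(3,4)[OF assms(3)], of g] circuitsD(3)[OF assms(3)]
    by (metis Max_ge finite_imageI image_eqI)
  then have "e \<in> deleted g F I S"
    unfolding deleted_def using T(1) crit by auto
  then show False
    using \<open>e \<in> C\<close> assms(4) by blast
qed

text \<open>Here \<open>n\<close> counts the rounds done and \<open>t\<close> those left. Each round
  preserves a maximum independent set inside \<open>S\<close> and raises the lower bound on circuit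
  lengths by the factor 3/2.\<close>

lemma result_deletion_alg:
  assumes F: "isolating_family E I F" and g: "inj_on g E"
    and "S \<subseteq> E" "B \<subseteq> S" "B \<in> I" "\<And>X. X \<in> I \<Longrightarrow> card X \<le> card B"
    and "\<And>C. C \<in> circuits E I \<Longrightarrow> C \<subseteq> S \<Longrightarrow> (3 / 2) ^ n \<le> real (card C)"
    and t: "real (card E) < (3 / 2) ^ (n + t)"
  shows "basis I (result I (deletion_alg g F t S))"
  using assms(3-)
proof (induction t arbitrary: S B n)
  case 0
  \<comment> \<open>With no round left, a circuit in \<open>S\<close> would have to be longer than
    the ground set.\<close>
  have "S \<in> I"
  proof (rule ccontr)
    assume "S \<notin> I"
    then obtain C where C: "C \<in> circuits E I" "C \<subseteq> S"
      using dependent_contains_circuit "0.prems"(1) by blast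
    have "card C \<le> card E"
      using card_mono[OF finite_ground circuitsD(1)[OF C(1)]] .
    moreover have "(3 / 2) ^ n \<le> real (card C)"
      by (rule "0.prems"(5)[OF C])
    ultimately show False
      using "0.prems"(6) by simp
  qed
  then show ?case
    using basis_of_max_card "0.prems" by simp
next
  case (Suc t)
  let ?S = "S - deleted g F I S"
  \<comment> \<open>Every nonempty critical set is a genuine circuit of \<open>S\<close>, also for
    samples that isolate no short circuit, so no deletion is harmful.\<close>
  have "\<exists>C\<in>circuits E I. C \<subseteq> S \<and> e \<in> C \<and> (\<forall>y\<in>C. g y \<le> g e)" if e: "e \<in> deleted g F I S" for e
  proof -
    obtain T where T: "e \<in> critical I (T \<inter> S)" "\<forall>y\<in>critical I (T \<inter> S). g y \<le> g e"
      using e unfolding deleted_def by blast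
    moreover have "critical I (T \<inter> S) \<in> circuits E I"
      using critical_circuit T(1) Suc.prems(1) by blast
    moreover have "critical I (T \<inter> S) \<subseteq> S"
      unfolding critical_def by blast
    ultimately show ?thesis by blast
  qed
  then obtain B' where B': "B' \<subseteq> ?S" "B' \<in> I" "\<And>X. X \<in> I \<Longrightarrow> card X \<le> card B'"
    using max_card_indep_avoids_circuit_maxima[OF g Suc.prems(1,2,3,4), of "deleted g F I S"] by blast
  \<comment> \<open>A surviving circuit already lies in \<open>S\<close>, so the girth of
    \<open>S\<close> is attained and the old bound applies to it.\<close>
  have "(3 / 2) ^ Suc n \<le> real (card C)" if C: "C \<in> circuits E I" "C \<subseteq> ?S" for C
  proof -
    obtain D where "D \<in> circuits E I" "D \<subseteq> S" "card D = girth E I S"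
      using girth_attained[OF C(1)] C(2) by blast
    then have "(3 / 2) ^ n \<le> real (girth E I S)"
      using Suc.prems(5) by metis
    moreover have "3 * girth E I S < 2 * card C"
      using deletion_destroys_short_circuits[OF F Suc.prems(1) C] .
    then have "3 * real (girth E I S) < 2 * real (card C)"
      by linarith
    ultimately show ?thesis by simp
  qed
  then have "basis I (result I (deletion_alg g F t ?S))"
    using Suc.IH[of ?S B' "Suc n"] B' Suc.prems(1,6) by auto
  then show ?case by simp
qed

corollary result_deletion_alg_ground:
  assumes "isolating_family E I F" "inj_on g E" "real (card E) < (3 / 2) ^ t"
  shows "basis I (result I (deletion_alg g F t E))"
proof -
  obtain B where B: "B \<subseteq> E" "B \<in> I" "\<And>X. X \<in> I \<Longrightarrow> card X \<le> card B"
    using ex_max_card_indep by blast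
  have "(3 / 2) ^ 0 \<le> real (card C)" if "C \<in> circuits E I" for C
    using circuitsD(3,4)[OF that] by (simp add: Suc_leI card_gt_0_iff)
  then show ?thesis
    using result_deletion_alg[OF assms(1,2) subset_refl B, of 0 t] assms(3) by simp
qed

end


section \<open>Isolating circuits by random subsets\<close>

definition random_subset :: "real \<Rightarrow> 'a set \<Rightarrow> 'a set pmf" where
  "random_subset p E = map_pmf (\<lambda>h. {e \<in> E. h e}) (Pi_pmf E False (\<lambda>_. bernoulli_pmf p))"

lemma prob_random_subset_superset:
  assumes "finite E" "X \<subseteq> E" "0 \<le> p" "p \<le> 1"
  shows "measure_pmf.prob (random_subset p E) {T. X \<subseteq> T} = p ^ card X"
proof -
  let ?B = "\<lambda>e. if e \<in> X then {True} else UNIV"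
  have "(\<lambda>h. {e \<in> E. h e}) -` {T. X \<subseteq> T} = Pi E ?B"
    using assms(2) by (auto simp: Pi_def split: if_splits)
  then have "measure_pmf.prob (random_subset p E) {T. X \<subseteq> T} =
      (\<Prod>e\<in>E. measure_pmf.prob (bernoulli_pmf p) (?B e))"
    unfolding random_subset_def measure_map_pmf using measure_Pi_pmf_Pi[OF assms(1)] by simp
  also have "\<dots> = (\<Prod>e\<in>E. if e \<in> X then p else 1)"
    using assms(3,4) by (intro prod.cong) (auto simp: measure_pmf_single)
  also have "\<dots> = (\<Prod>e\<in>X. p)"
    using assms(1,2) by (subst prod.inter_restrict[symmetric]) (auto simp: inf_absorb2)
  finally show ?thesis by simp
qed

lemma prob_Pi_pmf_Ball:
  assumes "finite A" "J \<subseteq> A"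
  shows "measure_pmf.prob (Pi_pmf A dflt p) {f. \<forall>i\<in>J. f i \<in> B} = (\<Prod>i\<in>J. measure_pmf.prob (p i) B)"
proof -
  let ?B = "\<lambda>i. if i \<in> J then B else UNIV"
  have "{f. \<forall>i\<in>J. f i \<in> B} = Pi A ?B"
    using assms(2) by (auto simp: Pi_def)
  then have "measure_pmf.prob (Pi_pmf A dflt p) {f. \<forall>i\<in>J. f i \<in> B} =
      (\<Prod>i\<in>A. measure_pmf.prob (p i) (?B i))"
    using measure_Pi_pmf_Pi[OF assms(1), of dflt p ?B] by simp
  also have "\<dots> = (\<Prod>i\<in>A. if i \<in> J then measure_pmf.prob (p i) B else 1)"
    by (intro prod.cong) auto
  also have "\<dots> = (\<Prod>i\<in>J. measure_pmf.prob (p i) B)"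
    using assms by (subst prod.inter_restrict[symmetric]) (auto simp: inf_absorb2)
  finally show ?thesis .
qed

text \<open>If \<open>C\<close> is sampled and misses an eighth of a circuit of length about \<open>\<alpha> l\<close>, that circuit is
  sampled as well with probability at most \<open>m powr (-2 (k + 1) \<alpha>)\<close>, which beats the \<open>m powr (k (\<alpha> + 1))\<close> circuits of that length.\<close>

definition sampling_rate :: "nat \<Rightarrow> nat \<Rightarrow> nat \<Rightarrow> real" where
  "sampling_rate k m l = real m powr (- (16 * (real k + 1) / real l))"

lemma sampling_rate_bounds:
  assumes "m \<ge> 1"
  shows "0 < sampling_rate k m l" "sampling_rate k m l \<le> 1"
proof -
  show "0 < sampling_rate k m l"
    using assms unfolding sampling_rate_def by simp
  have "real m powr (- (16 * (real k + 1) / real l)) \<le> real m powr 0"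
    using assms by (intro powr_mono) auto
  then show "sampling_rate k m l \<le> 1"
    using assms unfolding sampling_rate_def by simp
qed

lemma sampling_rate_power:
  assumes "m \<ge> 1"
  shows "sampling_rate k m l ^ n = real m powr (- (16 * (real k + 1) * real n / real l))"
  using assms unfolding sampling_rate_def
  by (simp add: powr_realpow[symmetric] powr_powr)

section \<open>Circuit counts and the probability of isolating a short circuit\<close>

context matroid
begin

lemma card_short_circuits:
  assumes "smooth_circuit_bound K E I" "K \<le> real k" "card E \<ge> 1" "S \<subseteq> E" "\<beta> \<ge> 1"
  shows "real (card {C \<in> circuits E I. C \<subseteq> S \<and> card C \<le> \<beta> * girth E I S}) \<le> real (card E) powr (real k * real \<beta>)"
\<comment> \<open>Without circuits the girth is unspecified, but then there is nothing to
  count.\<close>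
proof (cases "{C \<in> circuits E I. C \<subseteq> S} = {}")
  case True
  then have "{C \<in> circuits E I. C \<subseteq> S \<and> card C \<le> \<beta> * girth E I S} = {}" by blast
  then show ?thesis
    by (simp only: card.empty of_nat_0 powr_ge_zero)
next
  case False
  have "real (card {C \<in> {C \<in> circuits E I. C \<subseteq> S}. card C \<le> \<beta> * girth E I S})
      \<le> real (card E) powr (K * real \<beta>)"
    using assms(1)[unfolded smooth_circuit_bound_def Let_def, rule_format, OF assms(4) _ assms(5)] False
    unfolding circuits_restrict_indep[OF assms(4)] girth_def by blast
  also have "\<dots> \<le> real (card E) powr (real k * real \<beta>)"
    using assms(2,3) by (intro powr_mono mult_right_mono) auto
  finally show ?thesis by (simp add: conj_assoc)
qed

lemma girth_pos:
  assumes "C \<in> circuits E I" "C \<subseteq> S"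
  shows "girth E I S \<ge> 1"
proof -
  obtain D where "D \<in> circuits E I" "card D = girth E I S"
    using girth_attained[OF assms] by blast
  then show ?thesis
    using circuitsD(3,4)[of D] by (simp add: Suc_leI card_gt_0_iff flip: \<open>card D = girth E I S\<close>)
qed

end

context binary_matroid_locale
begin

text \<open>The symmetric difference of two distinct circuits contains a circuit, so a circuit of length
  at most \<open>3/2\<close> times the girth misses a constant fraction of every other one.\<close>

lemma card_circuit_diff:
  assumes C: "C \<in> circuits E I" "C \<subseteq> S" "2 * card C \<le> 3 * girth E I S"
    and D: "D \<in> circuits E I" "D \<subseteq> S" "D \<noteq> C" and "S \<subseteq> E"
  shows "card D \<le> 8 * card (D - C)"
proof -
  have fin: "finite C" "finite D"
    using circuitsD(3) C D by auto
  obtain X where X: "X \<in> circuits E I" "X \<subseteq> (C - D) \<union> (D - C)"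
    using dependent_contains_circuit[of "(C - D) \<union> (D - C)"] circuits_sym_diff_dependent[OF C(1) D(1)]
      C D circuitsD(1) by (metis Diff_subset Un_least order_trans)
  have "girth E I S \<le> card X"
    using girth_le[OF X(1)] X(2) C(2) D(2) by blast
  also have "\<dots> \<le> card ((C - D) \<union> (D - C))"
    using X(2) fin by (intro card_mono) auto
  also have "\<dots> \<le> card (C - D) + card (D - C)"
    by (rule card_Un_le)
  finally have "girth E I S \<le> card (C - D) + card (D - C)" .
  moreover have "girth E I S \<le> card D"
    using girth_le D by blast
  moreover have "card C = card (C - D) + card (C \<inter> D)" "card D = card (D - C) + card (C \<inter> D)"
    using fin by (metis add.commute card_Diff_subset_Int card_Int_Diff inf_commute)+
  \<comment> \<open>Let \<open>l\<close> be the girth. Adding the two lower bounds on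
    \<open>l\<close> gives \<open>2 * l \<le> card C + 2 * card (D - C)\<close>. Since
    \<open>card C\<close> is at most \<open>3 * l / 2\<close>, this yields
    \<open>l \<le> 4 * card (D - C)\<close>, and then
    \<open>card D \<le> card (D - C) + card C\<close> is at most
    \<open>7 * card (D - C)\<close>.\<close>
  ultimately show ?thesis
    using C(3) by linarith
qed

text \<open>Given that \<open>C\<close> is sampled, \<open>D\<close> is sampled too with probability
  \<open>p ^ card (D - C)\<close>, where \<open>p\<close> is the sampling rate. So this is the union
  bound for a second circuit appearing along with \<open>C\<close>.\<close>

lemma sum_sampling_rate_circuit_diff:
  assumes smooth: "smooth_circuit_bound K E I" "K \<le> real k"
    and m: "card E \<ge> 2" and S: "S \<subseteq> E"
    and C: "C \<in> circuits E I" "C \<subseteq> S" "2 * card C \<le> 3 * girth E I S"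
  shows "(\<Sum>D | D \<in> circuits E I \<and> D \<subseteq> S \<and> D \<noteq> C.
      sampling_rate k (card E) (girth E I S) ^ card (D - C)) \<le> 1 / 2"
proof -
  define l where "l = girth E I S"
  define m where "m = card E"
  let ?Ds = "{D. D \<in> circuits E I \<and> D \<subseteq> S \<and> D \<noteq> C}"
  let ?p = "sampling_rate k m l"
  have l: "l \<ge> 1"
    unfolding l_def using girth_pos[OF C(1,2)] .
  have m2: "m \<ge> 2" unfolding m_def by (fact m)
  have finDs: "finite ?Ds"
    using finite_circuits[of "\<lambda>D. D \<subseteq> S \<and> D \<noteq> C"] by simp
  have "(\<lambda>D. card D div l) ` ?Ds \<subseteq> {1..m}"
  proof clarsimp
    fix D assume D: "D \<in> circuits E I" "D \<subseteq> S"
    have "card D \<le> m"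
      unfolding m_def using card_mono[OF finite_ground circuitsD(1)[OF D(1)]] .
    then have "card D div l \<le> m"
      using div_le_dividend order_trans by blast
    moreover have "l \<le> card D"
      unfolding l_def using girth_le D by blast
    ultimately show "Suc 0 \<le> card D div l \<and> card D div l \<le> m"
      using l by (simp add: div_greater_zero_iff Suc_le_eq)
  qed
  \<comment> \<open>Circuits are grouped by length in units of the girth. There are at most
    \<open>m\<close> groups, each contributing at most \<open>m powr (- 2)\<close>, for a total of
    at most \<open>1 / m\<close>.\<close>
  then have "(\<Sum>D\<in>?Ds. ?p ^ card (D - C)) =
      (\<Sum>\<alpha>\<in>{1..m}. \<Sum>D\<in>{D \<in> ?Ds. card D div l = \<alpha>}. ?p ^ card (D - C))"
    by (intro sum.group[OF finDs, symmetric]) auto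
  also have "\<dots> \<le> (\<Sum>\<alpha>\<in>{1..m}. real m powr (- 2))"
  proof (rule sum_mono)
    fix \<alpha> assume \<alpha>: "\<alpha> \<in> {1..m}"
    have "?p ^ card (D - C) \<le> real m powr (- (2 * (real k + 1) * real \<alpha>))"
      if D: "D \<in> ?Ds" "card D div l = \<alpha>" for D
    proof -
      have "\<alpha> * l \<le> card D"
        using D(2) by (metis div_times_less_eq_dividend)
      also have "\<dots> \<le> 8 * card (D - C)"
        using card_circuit_diff[OF C] D(1) S by blast
      finally have "real \<alpha> * real l \<le> 8 * real (card (D - C))"
        by (metis (mono_tags) of_nat_le_iff of_nat_mult of_nat_numeral)
      then have "real \<alpha> \<le> 8 * real (card (D - C)) / real l"
        using l by (simp add: field_simps)
      then have "2 * (real k + 1) * real \<alpha> \<le> 2 * (real k + 1) * (8 * real (card (D - C)) / real l)"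
        by (intro mult_left_mono) auto
      then have "2 * (real k + 1) * real \<alpha> \<le> 16 * (real k + 1) * real (card (D - C)) / real l"
        by (simp add: algebra_simps)
      then show ?thesis
        using m2 by (subst sampling_rate_power) (auto intro!: powr_mono)
    qed
    then have "(\<Sum>D\<in>{D \<in> ?Ds. card D div l = \<alpha>}. ?p ^ card (D - C)) \<le>
        real (card {D \<in> ?Ds. card D div l = \<alpha>}) * real m powr (- (2 * (real k + 1) * real \<alpha>))"
      by (intro sum_bounded_above) auto
    \<comment> \<open>Rounding the length down to \<open>\<alpha>\<close> units loses less than one
      unit, so the count needs \<open>\<alpha> + 1\<close>; for \<open>\<alpha> \<ge> 1\<close> the
      rate still wins.\<close>
    also have "\<dots> \<le> real m powr (real k * real (\<alpha> + 1)) * real m powr (- (2 * (real k + 1) * real \<alpha>))"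
    proof (rule mult_right_mono)
      have "card D \<le> (\<alpha> + 1) * l" if "card D div l = \<alpha>" for D :: "'a set"
      proof -
        have "card D mod l < l"
          using l by simp
        then show ?thesis
          using div_mult_mod_eq[of "card D" l] unfolding that add_mult_distrib by linarith
      qed
      then have "{D \<in> ?Ds. card D div l = \<alpha>} \<subseteq> {D \<in> circuits E I. D \<subseteq> S \<and> card D \<le> (\<alpha> + 1) * l}"
        by blast
      then have "card {D \<in> ?Ds. card D div l = \<alpha>} \<le> card {D \<in> circuits E I. D \<subseteq> S \<and> card D \<le> (\<alpha> + 1) * l}"
        by (intro card_mono finite_circuits)
      also have "real \<dots> \<le> real m powr (real k * real (\<alpha> + 1))"
        unfolding l_def m_def using card_short_circuits[OF smooth _ S, of "\<alpha> + 1"] m by simp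
      finally show "real (card {D \<in> ?Ds. card D div l = \<alpha>}) \<le> real m powr (real k * real (\<alpha> + 1))"
        by simp
    qed simp
    also have "\<dots> = real m powr (real k - real k * real \<alpha> - 2 * real \<alpha>)"
      by (simp add: powr_add[symmetric] algebra_simps)
    also have "\<dots> \<le> real m powr (- 2)"
    proof (rule powr_mono)
      have "real k * 1 \<le> real k * real \<alpha>"
        using \<alpha> by (intro mult_left_mono) auto
      then show "real k - real k * real \<alpha> - 2 * real \<alpha> \<le> - 2"
        using \<alpha> by simp
    qed (use m2 in simp)
    finally show "(\<Sum>D\<in>{D \<in> ?Ds. card D div l = \<alpha>}. ?p ^ card (D - C)) \<le> real m powr (- 2)" .
  qed
  also have "\<dots> = 1 / real m"
    using m2 by (simp add: powr_minus powr_numeral power2_eq_square field_simps)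
  also have "\<dots> \<le> 1 / 2"
    using m2 by (simp add: field_simps)
  finally show ?thesis
    unfolding l_def m_def .
qed

text \<open>The set \<open>T\<close> contains \<open>C\<close> with probability
  \<open>p ^ card C\<close>, and a second circuit spoils at most half of this event.\<close>

lemma prob_isolates:
  assumes smooth: "smooth_circuit_bound K E I" "K \<le> real k"
    and m: "card E \<ge> 2" and S: "S \<subseteq> E"
    and C: "C \<in> circuits E I" "C \<subseteq> S" "2 * card C \<le> 3 * girth E I S"
  shows "measure_pmf.prob (random_subset (sampling_rate k (card E) (girth E I S)) E)
      {T. isolates E I S C T} \<ge> 1 / (2 * real (card E) ^ (24 * (k + 1)))"
proof -
  define p where "p = sampling_rate k (card E) (girth E I S)"
  let ?Ds = "{D. D \<in> circuits E I \<and> D \<subseteq> S \<and> D \<noteq> C}"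
  let ?P = "measure_pmf.prob (random_subset p E)"
  have p: "0 < p" "p \<le> 1"
    unfolding p_def using sampling_rate_bounds m by auto
  have finDs: "finite ?Ds"
    using finite_circuits[of "\<lambda>D. D \<subseteq> S \<and> D \<noteq> C"] by simp
  have sup: "?P {T. X \<subseteq> T} = p ^ card X" if "X \<subseteq> E" for X
    using prob_random_subset_superset[OF finite_ground that] p by simp
  have "p ^ card C = ?P {T. C \<subseteq> T}"
    using sup circuitsD(1)[OF C(1)] by simp
  \<comment> \<open>A sample containing \<open>C\<close> either isolates it or contains some further
    circuit \<open>D\<close> of \<open>S\<close>.\<close>
  also have "\<dots> \<le> ?P ({T. isolates E I S C T} \<union> (\<Union>D\<in>?Ds. {T. C \<union> D \<subseteq> T}))"
    using C by (intro measure_pmf.finite_measure_mono) (auto simp: isolates_def)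
  also have "\<dots> \<le> ?P {T. isolates E I S C T} + ?P (\<Union>D\<in>?Ds. {T. C \<union> D \<subseteq> T})"
    by (intro measure_Un_le) auto
  also have "?P (\<Union>D\<in>?Ds. {T. C \<union> D \<subseteq> T}) \<le> (\<Sum>D\<in>?Ds. ?P {T. C \<union> D \<subseteq> T})"
    using finDs by (intro measure_UNION_le) auto
  also have "\<dots> = (\<Sum>D\<in>?Ds. p ^ card C * p ^ card (D - C))"
  proof (rule sum.cong[OF refl])
    fix D assume D: "D \<in> ?Ds"
    then have "card (C \<union> D) = card C + card (D - C)"
      using circuitsD(3) C(1) by (metis Diff_disjoint Un_Diff_cancel card_Un_disjoint finite_Diff mem_Collect_eq)
    moreover have "C \<union> D \<subseteq> E"
      using D C(2) S by blast
    ultimately show "?P {T. C \<union> D \<subseteq> T} = p ^ card C * p ^ card (D - C)"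
      using sup[of "C \<union> D"] by (simp add: power_add)
  qed
  also have "\<dots> = p ^ card C * (\<Sum>D\<in>?Ds. p ^ card (D - C))"
    by (simp add: sum_distrib_left)
  also have "\<dots> \<le> p ^ card C * (1 / 2)"
    unfolding p_def using sum_sampling_rate_circuit_diff[OF assms] p
    by (intro mult_left_mono) (auto simp: p_def)
  finally have "p ^ card C / 2 \<le> ?P {T. isolates E I S C T}"
    by simp
  \<comment> \<open>The exponent 24 is the 16 of the sampling rate times the bound 3/2 on the ratio
    of \<open>card C\<close> to the girth.\<close>
  moreover have "1 / real (card E) ^ (24 * (k + 1)) \<le> p ^ card C"
  proof -
    have l: "girth E I S \<ge> 1"
      using girth_pos[OF C(1,2)] .
    have "2 * real (card C) \<le> 3 * real (girth E I S)"
      using C(3) by linarith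
    then have "real (card C) / real (girth E I S) \<le> 3 / 2"
      using l by (simp add: field_simps)
    then have "16 * (real k + 1) * (real (card C) / real (girth E I S)) \<le> 16 * (real k + 1) * (3 / 2)"
      by (intro mult_left_mono) auto
    then have "real (card E) powr (- (24 * (real k + 1))) \<le> p ^ card C"
      unfolding p_def using m by (subst sampling_rate_power) (auto intro!: powr_mono)
    moreover have "real (card E) powr (- (24 * (real k + 1))) = 1 / real (card E) ^ (24 * (k + 1))"
    proof -
      have "24 * (real k + 1) = real (24 * (k + 1))" by simp
      then show ?thesis
        using m by (simp only: powr_minus powr_realpow inverse_eq_divide)
    qed
    ultimately show ?thesis by simp
  qed
  ultimately show ?thesis
    unfolding p_def by (simp add: field_simps)
qed

end


section \<open>Random isolating families\<close>

text \<open>The girth is unknown, so every possible value is sampled for.\<close>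

definition sample_index :: "nat \<Rightarrow> nat \<Rightarrow> (nat \<times> nat) set" where
  "sample_index m N = {1..m} \<times> {..<N}"

definition random_family :: "nat \<Rightarrow> nat \<Rightarrow> 'a set \<Rightarrow> (nat \<times> nat \<Rightarrow> 'a set) pmf" where
  "random_family k N E = Pi_pmf (sample_index (card E) N) {}
    (\<lambda>(l, j). random_subset (sampling_rate k (card E) l) E)"

text \<open>Chosen so that the success probability of one sample,
  \<open>1 / (2 * m ^ (24 * (k + 1)))\<close>, times the number of samples is
  \<open>(c + 2) * m\<close>.\<close>

definition num_samples :: "nat \<Rightarrow> nat \<Rightarrow> nat \<Rightarrow> nat" where
  "num_samples k c m = 2 * (c + 2) * m ^ (24 * (k + 1) + 1)"

lemma finite_sample_index: "finite (sample_index m N)"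
  unfolding sample_index_def by simp

lemma card_image_sample_index: "card (f ` sample_index m N) \<le> m * N"
  using card_image_le[OF finite_sample_index, of f m N] unfolding sample_index_def by simp

lemma failure_bound:
  assumes "m \<ge> 1"
  shows "4 ^ m * (1 - 1 / (2 * real m ^ (24 * (k + 1)))) ^ num_samples k c m \<le> 1 / real m ^ c"
proof -
  let ?q = "1 / (2 * real m ^ (24 * (k + 1)))"
  have q: "0 \<le> ?q" "?q \<le> 1"
    using assms one_le_power[of "real m" "24 * (k + 1)"] by (auto simp: field_simps simp del: one_le_power)
  have qN: "?q * real (num_samples k c m) = real ((c + 2) * m)"
    using assms unfolding num_samples_def power_add by (simp add: divide_simps) (simp add: algebra_simps)
  have "(1 - ?q) ^ num_samples k c m \<le> exp (- ?q) ^ num_samples k c m"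
    using q exp_ge_add_one_self[of "- ?q"] by (intro power_mono) auto
  also have "\<dots> = exp (- (?q * real (num_samples k c m)))"
    by (simp add: exp_of_nat_mult[symmetric] mult.commute)
  also have "\<dots> = exp (- 1) ^ ((c + 2) * m)"
    unfolding qN by (simp add: exp_of_nat_mult[symmetric])
  \<comment> \<open>Of the exponent \<open>(c + 2) * m\<close>, the share \<open>2 * m\<close> pays
    for \<open>4 ^ m\<close>, the rest for the failure probability \<open>1 / m ^ c\<close>.\<close>
  also have "\<dots> = (exp (- 1) ^ 2) ^ m * (exp (- 1) ^ m) ^ c"
    by (simp add: power_mult[symmetric] power_add[symmetric] algebra_simps mult_2_right)
  finally have "4 ^ m * (1 - ?q) ^ num_samples k c m \<le>
      (4 * exp (- 1) ^ 2) ^ m * (exp (- 1) ^ m) ^ c"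
    by (simp add: power_mult_distrib mult.assoc)
  also have "\<dots> \<le> 1 * (1 / real m) ^ c"
  proof (intro mult_mono power_mono)
    have e: "2 \<le> exp (1 :: real)"
      using exp_ge_add_one_self[of 1] by simp
    have "2 ^ 2 \<le> exp (1 :: real) ^ 2"
      using e by (intro power_mono) auto
    then have "4 * exp (- 1 :: real) ^ 2 \<le> 1"
      by (simp add: exp_minus field_simps)
    then show "(4 * exp (- 1 :: real) ^ 2) ^ m \<le> 1"
      by (intro power_le_one) auto
    have "real m \<le> exp (real m)"
      using exp_ge_add_one_self[of "real m"] by linarith
    then show "exp (- 1) ^ m \<le> 1 / real m"
      using assms by (simp add: exp_of_nat_mult[symmetric] exp_minus field_simps)
  qed auto
  finally show ?thesis
    by (simp add: power_one_over)
qed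

context binary_matroid_locale
begin

text \<open>Union bound over all pairs of a set \<open>S\<close> and a short circuit
  \<open>C\<close> in it, of which there are at most \<open>4 ^ m\<close>.\<close>

lemma prob_isolating_family:
  assumes smooth: "smooth_circuit_bound K E I" "K \<le> real k"
  shows "measure_pmf.prob (random_family k (num_samples k c (card E)) E)
      {f. isolating_family E I (f ` sample_index (card E) (num_samples k c (card E)))}
    \<ge> 1 - 1 / real (card E) ^ c"
proof -
  define m where "m = card E"
  define N where "N = num_samples k c m"
  let ?R = "random_family k N E"
  let ?good = "{f. isolating_family E I (f ` sample_index m N)}"
  have "measure_pmf.prob ?R ?good \<ge> 1 - 1 / real m ^ c"
  proof -
    \<comment> \<open>The estimate for one sample needs \<open>m \<ge> 2\<close>. For
      \<open>m = 1\<close> the claimed bound is 0. For \<open>m = 0\<close> and \<open>c > 0\<close>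
      division by zero makes it 1, and indeed there is no circuit to isolate.\<close>
    consider "m = 0" | "m = 1" | "m \<ge> 2" by linarith
    then show ?thesis
    proof cases
      case 1
      then have "E = {}"
        using finite_ground unfolding m_def by simp
      then have "circuits E I = {}"
        using circuitsD(1,4) by blast
      then have "?good = UNIV"
        unfolding isolating_family_def by simp
      then show ?thesis
        by simp
    next
      case 2
      then show ?thesis by simp
    next
      case 3
      define q where "q = 1 / (2 * real m ^ (24 * (k + 1)))"
      define Ps where "Ps = {(S, C). S \<subseteq> E \<and> C \<in> circuits E I \<and> C \<subseteq> S \<and> 2 * card C \<le> 3 * girth E I S}"
      \<comment> \<open>Only the samples drawn at the rate for the true girth of \<open>S\<close>
        are used; being independent, they fail together with probability at most
        \<open>(1 - q) ^ N\<close>.\<close>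
      define bad where "bad = (\<lambda>(S, C). {f. \<forall>i\<in>{girth E I S} \<times> {..<N}. f i \<in> {T. \<not> isolates E I S C T}})"
      have Ps: "Ps \<subseteq> Pow E \<times> Pow E"
        unfolding Ps_def by blast
      then have finPs: "finite Ps"
        using finite_ground finite_subset by blast
      have "card Ps \<le> card (Pow E \<times> Pow E)"
        using Ps finite_ground by (intro card_mono) auto
      also have "\<dots> = 4 ^ m"
        using finite_ground unfolding m_def
        by (simp add: card_cartesian_product card_Pow power_mult_distrib[symmetric])
      finally have card_Ps: "real (card Ps) \<le> 4 ^ m"
        by (metis (mono_tags) of_nat_le_iff of_nat_numeral of_nat_power)
      have index: "{girth E I S} \<times> {..<N} \<subseteq> sample_index m N" if "(S, C) \<in> Ps" for S C
      proof -
        have SC: "C \<in> circuits E I" "C \<subseteq> S" "S \<subseteq> E"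
          using that unfolding Ps_def by auto
        have "girth E I S \<le> m"
          using girth_le[OF SC(1,2)] card_mono[OF finite_ground circuitsD(1)[OF SC(1)]]
          unfolding m_def by linarith
        then show ?thesis
          using girth_pos[OF SC(1,2)] unfolding sample_index_def by auto
      qed
      have "- ?good \<subseteq> (\<Union>x\<in>Ps. bad x)"
      proof
        fix f assume "f \<in> - ?good"
        then obtain S C where SC: "(S, C) \<in> Ps" "\<forall>T\<in>f ` sample_index m N. \<not> isolates E I S C T"
          unfolding isolating_family_def Ps_def by blast
        then have "f \<in> bad (S, C)"
          using index[OF SC(1)] unfolding bad_def by blast
        then show "f \<in> (\<Union>x\<in>Ps. bad x)"
          using SC(1) by blast
      qed
      then have "measure_pmf.prob ?R (- ?good) \<le> measure_pmf.prob ?R (\<Union>x\<in>Ps. bad x)"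
        by (intro measure_pmf.finite_measure_mono) auto
      also have "\<dots> \<le> (\<Sum>x\<in>Ps. measure_pmf.prob ?R (bad x))"
        using finPs by (intro measure_UNION_le) auto
      also have "\<dots> \<le> (\<Sum>x\<in>Ps. (1 - q) ^ N)"
      proof (rule sum_mono)
        fix x assume "x \<in> Ps"
        then obtain S C where x: "x = (S, C)" and SC: "(S, C) \<in> Ps"
          by (cases x) auto
        let ?D = "random_subset (sampling_rate k m (girth E I S)) E"
        have "measure_pmf.prob ?R (bad x) =
            (\<Prod>(l, j)\<in>{girth E I S} \<times> {..<N}.
              measure_pmf.prob (random_subset (sampling_rate k m l) E) {T. \<not> isolates E I S C T})"
          unfolding x bad_def random_family_def m_def[symmetric] prod.case
          by (subst prob_Pi_pmf_Ball[OF finite_sample_index index[OF SC]]) (simp add: case_prod_beta)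
        also have "\<dots> = measure_pmf.prob ?D {T. \<not> isolates E I S C T} ^ N"
          by (subst prod.cartesian_product[symmetric]) simp
        also have "measure_pmf.prob ?D {T. \<not> isolates E I S C T} =
            1 - measure_pmf.prob ?D {T. isolates E I S C T}"
          using measure_pmf.prob_compl[of "{T. isolates E I S C T}" ?D]
          by (simp add: Compl_eq_Diff_UNIV[symmetric] Collect_neg_eq)
        also have "\<dots> ^ N \<le> (1 - q) ^ N"
        proof (rule power_mono)
          have "q \<le> measure_pmf.prob ?D {T. isolates E I S C T}"
            using prob_isolates[OF smooth, of S C] 3 SC unfolding q_def m_def Ps_def by auto
          then show "1 - measure_pmf.prob ?D {T. isolates E I S C T} \<le> 1 - q"
            by simp
        qed simp
        finally show "measure_pmf.prob ?R (bad x) \<le> (1 - q) ^ N" .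
      qed
      also have "\<dots> = real (card Ps) * (1 - q) ^ N"
        by simp
      also have "\<dots> \<le> 4 ^ m * (1 - q) ^ N"
      proof (rule mult_right_mono[OF card_Ps])
        have "q \<le> 1"
          using 3 one_le_power[of "real m" "24 * (k + 1)"] unfolding q_def by (auto simp: field_simps simp del: one_le_power)
        then show "0 \<le> (1 - q) ^ N" by simp
      qed
      also have "\<dots> \<le> 1 / real m ^ c"
        unfolding q_def N_def using failure_bound 3 by simp
      finally show ?thesis
        using measure_pmf.prob_compl[of ?good ?R] by (simp add: Compl_eq_Diff_UNIV)
    qed
  qed
  then show ?thesis
    unfolding N_def m_def .
qed

end


section \<open>The round and query bounds\<close>

text \<open>For \<open>m \<ge> 1\<close>, the least exponent at which the power of 3/2 strictly
  exceeds \<open>m\<close>, also when the logarithm is an integer.\<close>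

definition num_rounds :: "nat \<Rightarrow> nat" where
  "num_rounds m = Suc (nat \<lfloor>log (3 / 2) (real m)\<rfloor>)"

lemma num_rounds_exceeds: "real m < (3 / 2) ^ num_rounds m"
proof (cases "m = 0")
  case False
  have "log (3 / 2) (real m) < real (num_rounds m)"
    unfolding num_rounds_def by linarith
  then have "real m < (3 / 2) powr real (num_rounds m)"
    using False by (simp add: log_less_iff)
  then show ?thesis
    by (simp add: powr_realpow)
qed simp

lemma num_rounds_bigo: "(\<lambda>m. real (num_rounds m)) \<in> O(\<lambda>m. ln (real m))"
proof (rule bigoI)
  show "\<forall>\<^sub>F m in sequentially. norm (real (num_rounds m)) \<le> (1 / ln (3 / 2) + 1) * norm (ln (real m))"
    using eventually_ge_at_top[of 3]
  proof eventually_elim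
    case (elim m)
    \<comment> \<open>From \<open>m \<ge> 3\<close> on, the logarithm is at least 1 and absorbs the
      additive constant.\<close>
    have "exp 1 \<le> real m"
      using exp_le elim by linarith
    then have ln: "1 \<le> ln (real m)"
      using elim by (subst ln_ge_iff) auto
    have "0 \<le> log (3 / 2) (real m)"
      using elim by simp
    then have "real (num_rounds m) \<le> log (3 / 2) (real m) + 1"
      unfolding num_rounds_def by linarith
    also have "\<dots> \<le> (1 / ln (3 / 2) + 1) * ln (real m)"
      using ln by (simp add: log_def algebra_simps)
    finally show ?case
      using ln by simp
  qed
qed

definition num_queries :: "nat \<Rightarrow> nat \<Rightarrow> nat \<Rightarrow> nat" where
  "num_queries k c m = m * num_samples k c m * Suc m"

lemma num_queries_bigo: "(\<lambda>m. real (num_queries k c m)) \<in> O(\<lambda>m. real m ^ (24 * (k + 1) + 3))"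
proof (rule bigoI)
  show "\<forall>\<^sub>F m in sequentially. norm (real (num_queries k c m)) \<le>
      real (4 * (c + 2)) * norm (real m ^ (24 * (k + 1) + 3))"
    using eventually_ge_at_top[of 1]
  proof eventually_elim
    case (elim m)
    have "num_queries k c m \<le> m * num_samples k c m * (2 * m)"
      unfolding num_queries_def using elim by (intro mult_left_mono) auto
    also have "\<dots> = 4 * (c + 2) * m ^ (24 * (k + 1) + 3)"
      unfolding num_samples_def by (simp add: power_add algebra_simps eval_nat_numeral)
    finally have "real (num_queries k c m) \<le> real (4 * (c + 2) * m ^ (24 * (k + 1) + 3))"
      by (simp only: of_nat_le_iff)
    then show ?case
      by simp
  qed
qed

text \<open>High probability is read as \<open>1 - 1 / m ^ c\<close> for any prescribed
  \<open>c\<close>. The algorithm and its bounds are chosen before the matroid, and \<open>A\<close>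
  is given only the ground set; the round and query bounds hold for every outcome of the random
  choice.\<close>

theorem mainTheorem4:
  fixes K :: real and c :: nat
  shows "\<exists>(A :: 'a set \<Rightarrow> 'a oracle_alg pmf) (r :: nat \<Rightarrow> nat) (q :: nat \<Rightarrow> nat) (d :: nat).
    (\<lambda>m. real (r m)) \<in> O(\<lambda>m. ln (real m)) \<and>
    (\<lambda>m. real (q m)) \<in> O(\<lambda>m. real m ^ d) \<and>
    (\<forall>E I. matroid E I \<and> binary_matroid E I \<and> smooth_circuit_bound K E I \<longrightarrow>
      (\<forall>a\<in>set_pmf (A E).
        rounds I a \<le> r (card E) \<and>
        (\<forall>Q\<in>set (batches I a). Q \<subseteq> Pow E \<and> card Q \<le> q (card E))) \<and>
      measure_pmf.prob (A E) {a. basis I (result I a)} \<ge> 1 - 1 / real (card E) ^ c)"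
proof -
  \<comment> \<open>Rounding \<open>K\<close> up to a natural number makes the exponents in the
    sample size integral and covers negative \<open>K\<close>.\<close>
  define k where "k = nat \<lceil>K\<rceil>"
  have K: "K \<le> real k"
    unfolding k_def by linarith
  define fam where "fam E f = f ` sample_index (card E) (num_samples k c (card E))"
    for E :: "'a set" and f :: "nat \<times> nat \<Rightarrow> 'a set"
  \<comment> \<open>Any injection into the naturals serves as the deletion order. All randomness
    lies in \<open>f\<close>, drawn once before the first round.\<close>
  define alg where "alg E f = deletion_alg (to_nat_on E) (fam E f) (num_rounds (card E)) E"
    for E :: "'a set" and f
  define A where "A E = map_pmf (alg E) (random_family k (num_samples k c (card E)) E)" for E
  have fam: "finite (fam E f)" "card (fam E f) \<le> card E * num_samples k c (card E)" for E f
    unfolding fam_def using card_image_sample_index finite_sample_index by auto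
  have "(\<forall>a\<in>set_pmf (A E).
        rounds I a \<le> num_rounds (card E) \<and>
        (\<forall>Q\<in>set (batches I a). Q \<subseteq> Pow E \<and> card Q \<le> num_queries k c (card E))) \<and>
      measure_pmf.prob (A E) {a. basis I (result I a)} \<ge> 1 - 1 / real (card E) ^ c"
    if M: "matroid E I" "binary_matroid E I" "smooth_circuit_bound K E I" for E :: "'a set" and I
  proof
    interpret binary_matroid_locale E I
      using M by (simp add: binary_matroid_locale_def binary_matroid_locale_axioms_def)
    show "\<forall>a\<in>set_pmf (A E). rounds I a \<le> num_rounds (card E) \<and>
        (\<forall>Q\<in>set (batches I a). Q \<subseteq> Pow E \<and> card Q \<le> num_queries k c (card E))"
    proof (intro ballI conjI)
      fix a assume "a \<in> set_pmf (A E)"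
      then obtain f where a: "a = alg E f"
        unfolding A_def by auto
      show "rounds I a \<le> num_rounds (card E)"
        unfolding a alg_def by (simp add: rounds_deletion_alg)
      fix Q assume "Q \<in> set (batches I a)"
      then have "Q \<in> set (batches I (deletion_alg (to_nat_on E) (fam E f) (num_rounds (card E)) E))"
        unfolding a alg_def .
      note Q = batches_deletion_alg[OF this fam(1) subset_refl finite_ground]
      show "Q \<subseteq> Pow E" by (fact Q(1))
      have "card (fam E f) * Suc (card E) \<le> num_queries k c (card E)"
        unfolding num_queries_def by (rule mult_right_mono[OF fam(2)]) simp
      then show "card Q \<le> num_queries k c (card E)"
        using Q(2) by linarith
    qed
    let ?R = "random_family k (num_samples k c (card E)) E"
    have "1 - 1 / real (card E) ^ c \<le> measure_pmf.prob ?R {f. isolating_family E I (fam E f)}"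
      unfolding fam_def by (rule prob_isolating_family[OF M(3) K])
    also have "\<dots> \<le> measure_pmf.prob ?R (alg E -` {a. basis I (result I a)})"
    proof (intro measure_pmf.finite_measure_mono)
      have "inj_on (to_nat_on E) E"
        using countable_finite[OF finite_ground] by (rule inj_on_to_nat_on)
      then show "{f. isolating_family E I (fam E f)} \<subseteq> alg E -` {a. basis I (result I a)}"
        unfolding alg_def using result_deletion_alg_ground num_rounds_exceeds by blast
    qed simp
    finally show "1 - 1 / real (card E) ^ c \<le> measure_pmf.prob (A E) {a. basis I (result I a)}"
      unfolding A_def by (simp add: measure_map_pmf)
  qed
  then show ?thesis
    using num_rounds_bigo num_queries_bigo[of k c]
    by (intro exI[of _ A] exI[of _ num_rounds] exI[of _ "num_queries k c"] exI[of _ "24 * (k + 1) + 3"]) blast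
qed

end
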